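(* Let $R$ be a semiring and let $A$ be an $R$-semialgebra. Then the map $$v_R^*\colon\operatorname{Sp}M_R(A)\longrightarrow\operatorname{Spec}A,\qquad \mathfrak{p}\longmapsto v_R^{-1}(\mathfrak{p})$$ is a homeomorphism.
   Context: A (commutative) semiring is a set $A$ with operations $+,\cdot$ such that $(A,+,0_A)$ and $(A,\cdot,1_A)$ are commutative monoids, $\cdot$ distributes over $+$, and $a\cdot 0_A=0_A$ for all $a$. It is idempotent if $a+a=a$ for all $a$. An ideal is a subset containing $0_A$, closed under addition and under multiplication by $A$; an ideal $\mathfrak{p}\neq A$ is prime if $ab\in\mathfrak{p}$ implies $a\in\mathfrak{p}$ or $b\in\mathfrak{p}$. An ideal $I$ is subtractive if $a+b=c$ with $b,c\in I$ implies $a\in I$. $\operatorname{Spec}A$ is the set of prime ideals of $A$, with the Zariski topology whose closed sets are $V(S)=\{\mathfrak{p}\mid S\subseteq\mathfrak{p}\}$, $S\subseteq A$. For any semiring $B$, $\operatorname{Sp}B\subseteq\operatorname{Spec}B$ is the set of prime subtractive ideals of $B$, with the subspace topology. An $R$-semialgebra is a semiring $A$ equipped with a semiring homomorphism $\iota\colon R\to A$. An $R$-subsemimodule of $A$ is a subset containing $0_A$, closed under addition and under multiplication by elements of $\iota(R)$; $\langle a_1,\ldots,a_n\rangle_R$ denotes the smallest one containing $a_1,\dots,a_n$. $M_R(A)$ is the set of finitely generated $R$-subsemimodules of $A$; it is an idempotent semiring with $M+N$ the sum of $R$-subsemimodules and $M\cdot N=\langle ab\mid a\in M,b\in N\rangle_R$,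 with additive identity $\{0_A\}$ and multiplicative identity $\langle1_A\rangle_R=\iota(R)$. The universal $G$-valuation of $A$ is the map $v_R\colon A\to M_R(A)$, $a\mapsto\langle a\rangle_R$. *)

theory Defs
  imports "HOL-Analysis.Abstract_Topology" "HOL-Algebra.AbelCoset"
begin

section \<open>Commutative semirings and their ideals\<close>

text \<open>
  The library's locale \<open>semiring\<close> of HOL-Algebra has an absorbing zero, does not assume
  commutativity of the multiplication, and admits the trivial semiring with \<open>\<zero> = \<one>\<close>.
\<close>

locale commutative_semiring = Ring.semiring A + comm_monoid A for A (structure)

text \<open>
  \<open>ring_hom\<close> does not require preservation of zero, which is not automatic without
  additive inverses.
\<close>

definition semiring_hom :: "('a, 'm) ring_scheme \<Rightarrow> ('b, 'n) ring_scheme \<Rightarrow> ('a \<Rightarrow> 'b) set"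
  where "semiring_hom R S = {h \<in> ring_hom R S. h \<zero>\<^bsub>R\<^esub> = \<zero>\<^bsub>S\<^esub>}"

text \<open>The library's \<open>ideal\<close> is an additive subgroup of a ring, hence not usable here.\<close>

definition semiring_ideal :: "('a, 'm) ring_scheme \<Rightarrow> 'a set \<Rightarrow> bool"
  where "semiring_ideal A I \<longleftrightarrow>
    I \<subseteq> carrier A \<and> \<zero>\<^bsub>A\<^esub> \<in> I \<and>
    (\<forall>x\<in>I. \<forall>y\<in>I. x \<oplus>\<^bsub>A\<^esub> y \<in> I) \<and>
    (\<forall>a\<in>carrier A. \<forall>x\<in>I. a \<otimes>\<^bsub>A\<^esub> x \<in> I)"

definition prime_semiring_ideal :: "('a, 'm) ring_scheme \<Rightarrow> 'a set \<Rightarrow> bool"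
  where "prime_semiring_ideal A P \<longleftrightarrow>
    semiring_ideal A P \<and> P \<noteq> carrier A \<and>
    (\<forall>a\<in>carrier A. \<forall>b\<in>carrier A. a \<otimes>\<^bsub>A\<^esub> b \<in> P \<longrightarrow> a \<in> P \<or> b \<in> P)"

definition subtractive :: "('a, 'm) ring_scheme \<Rightarrow> 'a set \<Rightarrow> bool"
  where "subtractive A I \<longleftrightarrow>
    (\<forall>a\<in>carrier A. \<forall>b\<in>I. \<forall>c\<in>I. a \<oplus>\<^bsub>A\<^esub> b = c \<longrightarrow> a \<in> I)"

section \<open>Spectra\<close>

definition Spec :: "('a, 'm) ring_scheme \<Rightarrow> 'a set set"
  where "Spec A = {P. prime_semiring_ideal A P}"

definition zariski_closed :: "('a, 'm) ring_scheme \<Rightarrow> 'a set \<Rightarrow> 'a set set"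
  where "zariski_closed A S = {P \<in> Spec A. S \<subseteq> P}"

definition zariski_topology :: "('a, 'm) ring_scheme \<Rightarrow> 'a set topology"
  where "zariski_topology A =
    topology (\<lambda>U. \<exists>S. S \<subseteq> carrier A \<and> U = Spec A - zariski_closed A S)"

definition Sp :: "('a, 'm) ring_scheme \<Rightarrow> 'a set set"
  where "Sp A = {P \<in> Spec A. subtractive A P}"

definition Sp_topology :: "('a, 'm) ring_scheme \<Rightarrow> 'a set topology"
  where "Sp_topology A = subtopology (zariski_topology A) (Sp A)"

context commutative_semiring
begin

lemma istopology_zariski:
  "istopology (\<lambda>U. \<exists>S. S \<subseteq> carrier A \<and> U = Spec A - zariski_closed A S)"
  unfolding istopology_def
proof (intro conjI allI impI)
  fix U V
  assume "\<exists>S. S \<subseteq> carrier A \<and> U = Spec A - zariski_closed A S"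
    and "\<exists>S. S \<subseteq> carrier A \<and> V = Spec A - zariski_closed A S"
  then obtain S T where S: "S \<subseteq> carrier A" "U = Spec A - zariski_closed A S"
    and T: "T \<subseteq> carrier A" "V = Spec A - zariski_closed A T" by blast
  define W where "W = {s \<otimes> t |s t. s \<in> S \<and> t \<in> T}"
  have "W \<subseteq> carrier A" using S T by (auto simp: W_def)
  moreover have "W \<subseteq> P \<longleftrightarrow> S \<subseteq> P \<or> T \<subseteq> P" if "P \<in> Spec A" for P
  proof
    have P: "prime_semiring_ideal A P" using that by (simp add: Spec_def)
    show "S \<subseteq> P \<or> T \<subseteq> P" if "W \<subseteq> P"
    proof (rule ccontr)
      assume "\<not> ?thesis"
      then obtain s t where st: "s \<in> S" "s \<notin> P" "t \<in> T" "t \<notin> P" by blast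
      then have "s \<otimes> t \<in> P" using that by (auto simp: W_def)
      then show False using st P S T unfolding prime_semiring_ideal_def by blast
    qed
    have L: "a \<otimes> x \<in> P" if "a \<in> carrier A" "x \<in> P" for a x
      using P that unfolding prime_semiring_ideal_def semiring_ideal_def by blast
    moreover have "x \<otimes> a \<in> P" if "a \<in> carrier A" "x \<in> P" for a x
    proof -
      have "x \<in> carrier A"
        using P that unfolding prime_semiring_ideal_def semiring_ideal_def by blast
      then show ?thesis using L[OF that] that by (simp add: m_comm)
    qed
    ultimately show "W \<subseteq> P" if "S \<subseteq> P \<or> T \<subseteq> P"
      using that S T unfolding W_def by blast
  qed
  ultimately show "\<exists>S. S \<subseteq> carrier A \<and> U \<inter> V = Spec A - zariski_closed A S"
    using S(2) T(2) by (intro exI[of _ W]) (auto simp: zariski_closed_def)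
next
  fix K
  assume "\<forall>U\<in>K. \<exists>S. S \<subseteq> carrier A \<and> U = Spec A - zariski_closed A S"
  then obtain f where f: "\<And>U. U \<in> K \<Longrightarrow> f U \<subseteq> carrier A \<and> U = Spec A - zariski_closed A (f U)"
    by metis
  have "P \<in> \<Union>K \<longleftrightarrow> P \<in> Spec A - zariski_closed A (\<Union>(f ` K))" for P
  proof -
    have "P \<in> U \<longleftrightarrow> P \<in> Spec A \<and> \<not> f U \<subseteq> P" if "U \<in> K" for U
      using f[OF that] unfolding zariski_closed_def by blast
    then show ?thesis unfolding zariski_closed_def by blast
  qed
  then have "\<Union>K = Spec A - zariski_closed A (\<Union>(f ` K))" by blast
  moreover have "\<Union>(f ` K) \<subseteq> carrier A" using f by blast
  ultimately show "\<exists>S. S \<subseteq> carrier A \<and> \<Union>K = Spec A - zariski_closed A S" by blast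
qed

lemma openin_zariski:
  "openin (zariski_topology A) U \<longleftrightarrow> (\<exists>S. S \<subseteq> carrier A \<and> U = Spec A - zariski_closed A S)"
  unfolding zariski_topology_def topology_inverse'[OF istopology_zariski] ..

lemma topspace_zariski: "topspace (zariski_topology A) = Spec A"
proof
  show "topspace (zariski_topology A) \<subseteq> Spec A"
    unfolding topspace_def openin_zariski by blast
  have "zariski_closed A (carrier A) = {}"
    unfolding zariski_closed_def Spec_def prime_semiring_ideal_def semiring_ideal_def by blast
  then have "openin (zariski_topology A) (Spec A)"
    unfolding openin_zariski by (intro exI[of _ "carrier A"]) simp
  then show "Spec A \<subseteq> topspace (zariski_topology A)" by (rule openin_subset)
qed

lemma closedin_zariski:
  "closedin (zariski_topology A) C \<longleftrightarrow> (\<exists>S. S \<subseteq> carrier A \<and> C = zariski_closed A S)"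
proof -
  have *: "zariski_closed A S \<subseteq> Spec A" for S by (auto simp: zariski_closed_def)
  show ?thesis
    unfolding closedin_def topspace_zariski openin_zariski using * by (metis double_diff subset_refl)
qed

lemma topspace_Sp: "topspace (Sp_topology A) = Sp A"
  by (auto simp: Sp_topology_def topspace_zariski Sp_def)

end

section \<open>Semialgebras and the semiring of finitely generated subsemimodules\<close>

locale semialgebra =
  R: commutative_semiring R + A: commutative_semiring A
  for R (structure) and A (structure) and \<iota> :: "'r \<Rightarrow> 'a" +
  assumes structure_hom: "\<iota> \<in> semiring_hom R A"

definition subsemimodule ::
    "('r, 'm) ring_scheme \<Rightarrow> ('a, 'n) ring_scheme \<Rightarrow> ('r \<Rightarrow> 'a) \<Rightarrow> 'a set \<Rightarrow> bool"
  where "subsemimodule R A \<iota> M \<longleftrightarrow>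
    M \<subseteq> carrier A \<and> \<zero>\<^bsub>A\<^esub> \<in> M \<and>
    (\<forall>x\<in>M. \<forall>y\<in>M. x \<oplus>\<^bsub>A\<^esub> y \<in> M) \<and>
    (\<forall>r\<in>carrier R. \<forall>x\<in>M. \<iota> r \<otimes>\<^bsub>A\<^esub> x \<in> M)"

definition semimodule_span ::
    "('r, 'm) ring_scheme \<Rightarrow> ('a, 'n) ring_scheme \<Rightarrow> ('r \<Rightarrow> 'a) \<Rightarrow> 'a set \<Rightarrow> 'a set"
  where "semimodule_span R A \<iota> X = \<Inter>{M. subsemimodule R A \<iota> M \<and> X \<subseteq> M}"

text \<open>
  \<open>M <#> N\<close> and \<open>M <+> N\<close> are the elementwise products and sums.
\<close>

definition fg_subsemimodules ::
    "('r, 'm) ring_scheme \<Rightarrow> ('a, 'n) ring_scheme \<Rightarrow> ('r \<Rightarrow> 'a) \<Rightarrow> 'a set ring"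
  where "fg_subsemimodules R A \<iota> =
    \<lparr>carrier = {semimodule_span R A \<iota> F |F. finite F \<and> F \<subseteq> carrier A},
     mult = (\<lambda>M N. semimodule_span R A \<iota> (M <#>\<^bsub>A\<^esub> N)),
     one = semimodule_span R A \<iota> {\<one>\<^bsub>A\<^esub>},
     zero = {\<zero>\<^bsub>A\<^esub>},
     add = (\<lambda>M N. M <+>\<^bsub>A\<^esub> N)\<rparr>"

definition universal_valuation ::
    "('r, 'm) ring_scheme \<Rightarrow> ('a, 'n) ring_scheme \<Rightarrow> ('r \<Rightarrow> 'a) \<Rightarrow> 'a \<Rightarrow> 'a set"
  where "universal_valuation R A \<iota> a = semimodule_span R A \<iota> {a}"

definition universal_valuation_pullback ::
    "('r, 'm) ring_scheme \<Rightarrow> ('a, 'n) ring_scheme \<Rightarrow> ('r \<Rightarrow> 'a) \<Rightarrow> 'a set set \<Rightarrow> 'a set"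
  where "universal_valuation_pullback R A \<iota> P =
    {a \<in> carrier A. universal_valuation R A \<iota> a \<in> P}"

context semialgebra
begin

abbreviation span where "span \<equiv> semimodule_span R A \<iota>"

lemma structure_closed: "r \<in> carrier R \<Longrightarrow> \<iota> r \<in> carrier A"
  using structure_hom by (auto simp: semiring_hom_def ring_hom_def)

lemma subsemimodule_carrier: "subsemimodule R A \<iota> (carrier A)"
  by (auto simp: subsemimodule_def structure_closed)

lemma subsemimodule_span: "X \<subseteq> carrier A \<Longrightarrow> subsemimodule R A \<iota> (span X)"
  using subsemimodule_carrier unfolding semimodule_span_def
  by (subst subsemimodule_def) (auto simp: subsemimodule_def)

lemma span_superset: "X \<subseteq> span X"
  unfolding semimodule_span_def by blast

lemma span_least: "subsemimodule R A \<iota> M \<Longrightarrow> X \<subseteq> M \<Longrightarrow> span X \<subseteq> M"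
  unfolding semimodule_span_def by blast

lemma span_closed: "X \<subseteq> carrier A \<Longrightarrow> span X \<subseteq> carrier A"
  using subsemimodule_span unfolding subsemimodule_def by blast

lemma set_add_iff: "x \<in> M <+>\<^bsub>A\<^esub> N \<longleftrightarrow> (\<exists>m\<in>M. \<exists>n\<in>N. x = m \<oplus>\<^bsub>A\<^esub> n)"
  by (auto simp: set_add_def set_mult_def)

lemma set_mult_iff: "x \<in> M <#>\<^bsub>A\<^esub> N \<longleftrightarrow> (\<exists>m\<in>M. \<exists>n\<in>N. x = m \<otimes>\<^bsub>A\<^esub> n)"
  by (auto simp: set_mult_def)

lemma span_empty: "span {} = {\<zero>\<^bsub>A\<^esub>}"
proof
  show "span {} \<subseteq> {\<zero>\<^bsub>A\<^esub>}"
    by (rule span_least) (auto simp: subsemimodule_def structure_closed)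
  show "{\<zero>\<^bsub>A\<^esub>} \<subseteq> span {}"
    using subsemimodule_span[of "{}"] by (simp add: subsemimodule_def)
qed

lemma span_one: "span {\<one>\<^bsub>A\<^esub>} = \<iota> ` carrier R"
proof
  have h: "\<And>x y. x \<in> carrier R \<Longrightarrow> y \<in> carrier R \<Longrightarrow> \<iota> (x \<otimes>\<^bsub>R\<^esub> y) = \<iota> x \<otimes>\<^bsub>A\<^esub> \<iota> y"
    "\<And>x y. x \<in> carrier R \<Longrightarrow> y \<in> carrier R \<Longrightarrow> \<iota> (x \<oplus>\<^bsub>R\<^esub> y) = \<iota> x \<oplus>\<^bsub>A\<^esub> \<iota> y"
    "\<iota> \<one>\<^bsub>R\<^esub> = \<one>\<^bsub>A\<^esub>" "\<iota> \<zero>\<^bsub>R\<^esub> = \<zero>\<^bsub>A\<^esub>"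
    using structure_hom by (auto simp: semiring_hom_def ring_hom_def)
  have "subsemimodule R A \<iota> (\<iota> ` carrier R)"
    unfolding subsemimodule_def
  proof (intro conjI ballI)
    show "\<iota> ` carrier R \<subseteq> carrier A" using structure_closed by blast
    show "\<zero>\<^bsub>A\<^esub> \<in> \<iota> ` carrier R" using h(4) R.zero_closed by (metis imageI)
    show "x \<oplus>\<^bsub>A\<^esub> y \<in> \<iota> ` carrier R" if "x \<in> \<iota> ` carrier R" "y \<in> \<iota> ` carrier R" for x y
      using that h(2) by (metis (no_types, lifting) R.add.m_closed imageE imageI)
    show "\<iota> r \<otimes>\<^bsub>A\<^esub> x \<in> \<iota> ` carrier R" if "r \<in> carrier R" "x \<in> \<iota> ` carrier R" for r x
      using that h(1) by (metis (no_types, lifting) R.m_closed imageE imageI)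
  qed
  then show "span {\<one>\<^bsub>A\<^esub>} \<subseteq> \<iota> ` carrier R"
  proof (rule span_least)
    show "{\<one>\<^bsub>A\<^esub>} \<subseteq> \<iota> ` carrier R"
      using h(3) R.one_closed by (metis empty_subsetI imageI insert_subset)
  qed
  have "\<iota> r \<in> span {\<one>\<^bsub>A\<^esub>}" if "r \<in> carrier R" for r
  proof -
    have "\<iota> r \<otimes>\<^bsub>A\<^esub> \<one>\<^bsub>A\<^esub> \<in> span {\<one>\<^bsub>A\<^esub>}"
      using subsemimodule_span[of "{\<one>\<^bsub>A\<^esub>}"] span_superset[of "{\<one>\<^bsub>A\<^esub>}"] that
      by (auto simp: subsemimodule_def)
    then show ?thesis using structure_closed[OF that] by simp
  qed
  then show "\<iota> ` carrier R \<subseteq> span {\<one>\<^bsub>A\<^esub>}" by blast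
qed

lemma subsemimodule_set_add:
  assumes M: "subsemimodule R A \<iota> M" and N: "subsemimodule R A \<iota> N"
  shows "subsemimodule R A \<iota> (M <+>\<^bsub>A\<^esub> N)"
  unfolding subsemimodule_def
proof (intro conjI ballI)
  have c: "M \<subseteq> carrier A" "N \<subseteq> carrier A" and z: "\<zero>\<^bsub>A\<^esub> \<in> M" "\<zero>\<^bsub>A\<^esub> \<in> N"
    using M N by (auto simp: subsemimodule_def)
  show "M <+>\<^bsub>A\<^esub> N \<subseteq> carrier A" using c by (auto simp: set_add_iff subset_iff)
  show "\<zero>\<^bsub>A\<^esub> \<in> M <+>\<^bsub>A\<^esub> N" using z by (force simp: set_add_iff)
  fix x assume "x \<in> M <+>\<^bsub>A\<^esub> N"
  then obtain m n where x: "m \<in> M" "n \<in> N" "x = m \<oplus>\<^bsub>A\<^esub> n" by (auto simp: set_add_iff)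
  then have mn: "m \<in> carrier A" "n \<in> carrier A" using c by auto
  {
    fix y assume "y \<in> M <+>\<^bsub>A\<^esub> N"
    then obtain m' n' where y: "m' \<in> M" "n' \<in> N" "y = m' \<oplus>\<^bsub>A\<^esub> n'" by (auto simp: set_add_iff)
    then have mn': "m' \<in> carrier A" "n' \<in> carrier A" using c by auto
    have "x \<oplus>\<^bsub>A\<^esub> y = (m \<oplus>\<^bsub>A\<^esub> m') \<oplus>\<^bsub>A\<^esub> (n \<oplus>\<^bsub>A\<^esub> n')"
      using x y mn mn' by (simp add: A.a_ac)
    moreover have "m \<oplus>\<^bsub>A\<^esub> m' \<in> M" "n \<oplus>\<^bsub>A\<^esub> n' \<in> N"
      using M N x y by (auto simp: subsemimodule_def)
    ultimately show "x \<oplus>\<^bsub>A\<^esub> y \<in> M <+>\<^bsub>A\<^esub> N" by (auto simp: set_add_iff)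
  next
    fix r assume r: "r \<in> carrier R"
    have "\<iota> r \<otimes>\<^bsub>A\<^esub> x = \<iota> r \<otimes>\<^bsub>A\<^esub> m \<oplus>\<^bsub>A\<^esub> \<iota> r \<otimes>\<^bsub>A\<^esub> n"
      using x mn structure_closed[OF r] by (simp add: A.r_distr)
    moreover have "\<iota> r \<otimes>\<^bsub>A\<^esub> m \<in> M" "\<iota> r \<otimes>\<^bsub>A\<^esub> n \<in> N"
      using M N x r by (auto simp: subsemimodule_def)
    ultimately show "\<iota> r \<otimes>\<^bsub>A\<^esub> x \<in> M <+>\<^bsub>A\<^esub> N" by (auto simp: set_add_iff)
  }
qed

lemma span_add:
  assumes F: "F \<subseteq> carrier A" and G: "G \<subseteq> carrier A"
  shows "span F <+>\<^bsub>A\<^esub> span G = span (F \<union> G)"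
proof
  have sF: "subsemimodule R A \<iota> (span F)" and sG: "subsemimodule R A \<iota> (span G)"
    and sU: "subsemimodule R A \<iota> (span (F \<union> G))"
    using F G by (auto intro: subsemimodule_span)
  have "span F \<subseteq> span (F \<union> G)" "span G \<subseteq> span (F \<union> G)"
    using span_superset[of "F \<union> G"] by (simp_all add: span_least[OF sU])
  then show "span F <+>\<^bsub>A\<^esub> span G \<subseteq> span (F \<union> G)"
    using sU unfolding subsemimodule_def by (auto simp: set_add_iff subset_iff)
  have z: "\<zero>\<^bsub>A\<^esub> \<in> span F" "\<zero>\<^bsub>A\<^esub> \<in> span G" using sF sG by (auto simp: subsemimodule_def)
  show "span (F \<union> G) \<subseteq> span F <+>\<^bsub>A\<^esub> span G"
  proof (rule span_least[OF subsemimodule_set_add[OF sF sG]], rule subsetI)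
    fix x assume x: "x \<in> F \<union> G"
    then have xc: "x \<in> carrier A" using F G by auto
    show "x \<in> span F <+>\<^bsub>A\<^esub> span G"
    proof (cases "x \<in> F")
      case True
      then have "x \<in> span F" using span_superset by blast
      moreover have "x = x \<oplus>\<^bsub>A\<^esub> \<zero>\<^bsub>A\<^esub>" using xc by simp
      ultimately show ?thesis using z unfolding set_add_iff by blast
    next
      case False
      then have "x \<in> span G" using x span_superset by blast
      moreover have "x = \<zero>\<^bsub>A\<^esub> \<oplus>\<^bsub>A\<^esub> x" using xc by simp
      ultimately show ?thesis using z unfolding set_add_iff by blast
    qed
  qed
qed

lemma subsemimodule_colon:
  assumes P: "subsemimodule R A \<iota> P" and G: "G \<subseteq> carrier A"
  shows "subsemimodule R A \<iota> {a \<in> carrier A. \<forall>b\<in>G. a \<otimes>\<^bsub>A\<^esub> b \<in> P}"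
  using P G unfolding subsemimodule_def
  by (auto simp: structure_closed A.l_distr A.m_assoc subset_iff)

lemma span_mult:
  assumes F: "F \<subseteq> carrier A" and G: "G \<subseteq> carrier A"
  shows "span (span F <#>\<^bsub>A\<^esub> span G) = span (F <#>\<^bsub>A\<^esub> G)"
proof
  let ?P = "span (F <#>\<^bsub>A\<^esub> G)"
  have FG: "F <#>\<^bsub>A\<^esub> G \<subseteq> carrier A" using F G by (auto simp: set_mult_iff subset_iff)
  have sP: "subsemimodule R A \<iota> ?P" by (rule subsemimodule_span[OF FG])
  have "span F \<subseteq> {a \<in> carrier A. \<forall>b\<in>G. a \<otimes>\<^bsub>A\<^esub> b \<in> ?P}"
    using F span_superset[of "F <#>\<^bsub>A\<^esub> G"]
    by (intro span_least[OF subsemimodule_colon[OF sP G]]) (auto simp: set_mult_iff subset_iff)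
  then have 1: "a \<otimes>\<^bsub>A\<^esub> b \<in> ?P" if "a \<in> span F" "b \<in> G" for a b using that by auto
  have "span G \<subseteq> {b \<in> carrier A. \<forall>a\<in>span F. b \<otimes>\<^bsub>A\<^esub> a \<in> ?P}"
  proof (intro span_least[OF subsemimodule_colon[OF sP span_closed[OF F]]] subsetI CollectI conjI ballI)
    fix b a assume b: "b \<in> G" and a: "a \<in> span F"
    have "b \<in> carrier A" "a \<in> carrier A" using a b G span_closed[OF F] by auto
    then show "b \<otimes>\<^bsub>A\<^esub> a \<in> ?P" using 1[OF a b] by (simp add: A.m_comm)
  qed (use G in auto)
  then have 2: "b \<otimes>\<^bsub>A\<^esub> a \<in> ?P" if "a \<in> span F" "b \<in> span G" for a b using that by auto
  have "a \<otimes>\<^bsub>A\<^esub> b \<in> ?P" if "a \<in> span F" "b \<in> span G" for a b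
    using 2[OF that] that span_closed[OF F] span_closed[OF G] by (metis A.m_comm subsetD)
  then show "span (span F <#>\<^bsub>A\<^esub> span G) \<subseteq> ?P"
    by (intro span_least[OF sP]) (auto simp: set_mult_iff)
  have c: "span F <#>\<^bsub>A\<^esub> span G \<subseteq> carrier A"
    using span_closed[OF F] span_closed[OF G] by (auto simp: set_mult_iff subset_iff)
  have "F <#>\<^bsub>A\<^esub> G \<subseteq> span F <#>\<^bsub>A\<^esub> span G"
    using span_superset unfolding set_mult_iff subset_iff by blast
  then show "?P \<subseteq> span (span F <#>\<^bsub>A\<^esub> span G)"
    using span_superset[of "span F <#>\<^bsub>A\<^esub> span G"]
    by (intro span_least[OF subsemimodule_span[OF c]]) auto
qed

lemma finite_set_mult: "finite F \<Longrightarrow> finite G \<Longrightarrow> finite (F <#>\<^bsub>A\<^esub> G)"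
  by (auto simp: set_mult_def)

lemma set_mult_closed: "F \<subseteq> carrier A \<Longrightarrow> G \<subseteq> carrier A \<Longrightarrow> F <#>\<^bsub>A\<^esub> G \<subseteq> carrier A"
  by (auto simp: set_mult_iff subset_iff)

lemma fg_subsemimodules_semiring: "commutative_semiring (fg_subsemimodules R A \<iota>)"
proof -
  let ?M = "fg_subsemimodules R A \<iota>"
  have in_carrier: "M \<in> carrier ?M \<longleftrightarrow> (\<exists>F. finite F \<and> F \<subseteq> carrier A \<and> M = span F)" for M
    by (auto simp: fg_subsemimodules_def)
  have elim: thesis if "M \<in> carrier ?M" "\<And>F. finite F \<Longrightarrow> F \<subseteq> carrier A \<Longrightarrow> M = span F \<Longrightarrow> thesis"
    for M thesis using that in_carrier by blast
  have zero: "\<zero>\<^bsub>?M\<^esub> = span {}" by (simp add: fg_subsemimodules_def span_empty)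
  have one: "\<one>\<^bsub>?M\<^esub> = span {\<one>\<^bsub>A\<^esub>}" by (simp add: fg_subsemimodules_def)
  have add: "span F \<oplus>\<^bsub>?M\<^esub> span G = span (F \<union> G)" if "F \<subseteq> carrier A" "G \<subseteq> carrier A" for F G
    using span_add[OF that] by (simp add: fg_subsemimodules_def)
  have mult: "span F \<otimes>\<^bsub>?M\<^esub> span G = span (F <#>\<^bsub>A\<^esub> G)"
    if "F \<subseteq> carrier A" "G \<subseteq> carrier A" for F G
    using span_mult[OF that] by (simp add: fg_subsemimodules_def)
  have assoc: "(F <#>\<^bsub>A\<^esub> G) <#>\<^bsub>A\<^esub> H = F <#>\<^bsub>A\<^esub> (G <#>\<^bsub>A\<^esub> H)"
    if "F \<subseteq> carrier A" "G \<subseteq> carrier A" "H \<subseteq> carrier A" for F G H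
  proof -
    have *: "(a \<otimes>\<^bsub>A\<^esub> b) \<otimes>\<^bsub>A\<^esub> c = a \<otimes>\<^bsub>A\<^esub> (b \<otimes>\<^bsub>A\<^esub> c)"
      if "a \<in> F" "b \<in> G" "c \<in> H" for a b c
      using that \<open>F \<subseteq> carrier A\<close> \<open>G \<subseteq> carrier A\<close> \<open>H \<subseteq> carrier A\<close> by (auto intro!: A.m_assoc)
    have m: "a \<otimes>\<^bsub>A\<^esub> b \<in> X <#>\<^bsub>A\<^esub> Y" if "a \<in> X" "b \<in> Y" for a b X Y
      using that by (auto simp: set_mult_iff)
    show ?thesis
    proof (intro equalityI subsetI)
      fix x assume "x \<in> (F <#>\<^bsub>A\<^esub> G) <#>\<^bsub>A\<^esub> H"
      then obtain u c where 1: "u \<in> F <#>\<^bsub>A\<^esub> G" "c \<in> H" "x = u \<otimes>\<^bsub>A\<^esub> c" by (auto simp: set_mult_iff)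
      then obtain a b where 2: "a \<in> F" "b \<in> G" "u = a \<otimes>\<^bsub>A\<^esub> b" by (auto simp: set_mult_iff)
      have "x = a \<otimes>\<^bsub>A\<^esub> (b \<otimes>\<^bsub>A\<^esub> c)" using 1 2 *[of a b c] by simp
      then show "x \<in> F <#>\<^bsub>A\<^esub> (G <#>\<^bsub>A\<^esub> H)" using 1 2 by (simp add: m)
    next
      fix x assume "x \<in> F <#>\<^bsub>A\<^esub> (G <#>\<^bsub>A\<^esub> H)"
      then obtain a u where 1: "u \<in> G <#>\<^bsub>A\<^esub> H" "a \<in> F" "x = a \<otimes>\<^bsub>A\<^esub> u" by (auto simp: set_mult_iff)
      then obtain b c where 2: "b \<in> G" "c \<in> H" "u = b \<otimes>\<^bsub>A\<^esub> c" by (auto simp: set_mult_iff)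
      have "x = (a \<otimes>\<^bsub>A\<^esub> b) \<otimes>\<^bsub>A\<^esub> c" using 1 2 *[of a b c] by simp
      then show "x \<in> (F <#>\<^bsub>A\<^esub> G) <#>\<^bsub>A\<^esub> H" using 1 2 by (simp add: m)
    qed
  qed
  have comm: "F <#>\<^bsub>A\<^esub> G = G <#>\<^bsub>A\<^esub> F" if "F \<subseteq> carrier A" "G \<subseteq> carrier A" for F G
    using that unfolding set_eq_iff set_mult_iff by (metis A.m_comm subsetD)
  have lone: "{\<one>\<^bsub>A\<^esub>} <#>\<^bsub>A\<^esub> F = F" if "F \<subseteq> carrier A" for F
    using that by (force simp: set_mult_iff)
  have ldist: "(F \<union> G) <#>\<^bsub>A\<^esub> H = (F <#>\<^bsub>A\<^esub> H) \<union> (G <#>\<^bsub>A\<^esub> H)" for F G H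
    by (auto simp: set_mult_def)
  have rdist: "H <#>\<^bsub>A\<^esub> (F \<union> G) = (H <#>\<^bsub>A\<^esub> F) \<union> (H <#>\<^bsub>A\<^esub> G)" for F G H
    by (auto simp: set_mult_def)
  have lz: "{} <#>\<^bsub>A\<^esub> H = {}" and rz: "H <#>\<^bsub>A\<^esub> {} = {}" for H
    by (auto simp: set_mult_def)
  note sm = add mult set_mult_closed zero one
  have "abelian_monoid ?M"
  proof (rule abelian_monoidI)
    show "x \<oplus>\<^bsub>?M\<^esub> y \<in> carrier ?M" if "x \<in> carrier ?M" "y \<in> carrier ?M" for x y
      using that by (elim elim) (auto simp: sm in_carrier)
    show "\<zero>\<^bsub>?M\<^esub> \<in> carrier ?M" by (auto simp: zero in_carrier)
    show "x \<oplus>\<^bsub>?M\<^esub> y \<oplus>\<^bsub>?M\<^esub> z = x \<oplus>\<^bsub>?M\<^esub> (y \<oplus>\<^bsub>?M\<^esub> z)"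
      if "x \<in> carrier ?M" "y \<in> carrier ?M" "z \<in> carrier ?M" for x y z
      using that by (elim elim) (simp add: sm Un_assoc)
    show "\<zero>\<^bsub>?M\<^esub> \<oplus>\<^bsub>?M\<^esub> x = x" if "x \<in> carrier ?M" for x
      using that by (elim elim) (simp add: sm)
    show "x \<oplus>\<^bsub>?M\<^esub> y = y \<oplus>\<^bsub>?M\<^esub> x" if "x \<in> carrier ?M" "y \<in> carrier ?M" for x y
      using that by (elim elim) (simp add: sm Un_commute)
  qed
  moreover have "comm_monoid ?M"
  proof (rule comm_monoidI)
    show "x \<otimes>\<^bsub>?M\<^esub> y \<in> carrier ?M" if xy: "x \<in> carrier ?M" "y \<in> carrier ?M" for x y
    proof -
      obtain F where F: "finite F" "F \<subseteq> carrier A" "x = span F" using xy(1) unfolding in_carrier by blast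
      obtain G where G: "finite G" "G \<subseteq> carrier A" "y = span G" using xy(2) unfolding in_carrier by blast
      have "finite (F <#>\<^bsub>A\<^esub> G)" "F <#>\<^bsub>A\<^esub> G \<subseteq> carrier A" "x \<otimes>\<^bsub>?M\<^esub> y = span (F <#>\<^bsub>A\<^esub> G)"
        using F G by (simp_all add: finite_set_mult set_mult_closed mult)
      then show ?thesis using in_carrier by blast
    qed
    show "\<one>\<^bsub>?M\<^esub> \<in> carrier ?M" unfolding one in_carrier
      by (intro exI[of _ "{\<one>\<^bsub>A\<^esub>}"]) auto
    show "x \<otimes>\<^bsub>?M\<^esub> y \<otimes>\<^bsub>?M\<^esub> z = x \<otimes>\<^bsub>?M\<^esub> (y \<otimes>\<^bsub>?M\<^esub> z)"
      if "x \<in> carrier ?M" "y \<in> carrier ?M" "z \<in> carrier ?M" for x y z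
      using that by (elim elim) (simp add: sm assoc)
    show "\<one>\<^bsub>?M\<^esub> \<otimes>\<^bsub>?M\<^esub> x = x" if "x \<in> carrier ?M" for x
      using that by (elim elim) (simp add: sm lone)
    show "x \<otimes>\<^bsub>?M\<^esub> y = y \<otimes>\<^bsub>?M\<^esub> x" if "x \<in> carrier ?M" "y \<in> carrier ?M" for x y
      using that by (elim elim) (simp add: sm comm)
  qed
  moreover have "semiring_axioms ?M"
  proof
    show "(x \<oplus>\<^bsub>?M\<^esub> y) \<otimes>\<^bsub>?M\<^esub> z = x \<otimes>\<^bsub>?M\<^esub> z \<oplus>\<^bsub>?M\<^esub> y \<otimes>\<^bsub>?M\<^esub> z"
      if "x \<in> carrier ?M" "y \<in> carrier ?M" "z \<in> carrier ?M" for x y z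
      using that by (elim elim) (simp add: sm ldist)
    show "z \<otimes>\<^bsub>?M\<^esub> (x \<oplus>\<^bsub>?M\<^esub> y) = z \<otimes>\<^bsub>?M\<^esub> x \<oplus>\<^bsub>?M\<^esub> z \<otimes>\<^bsub>?M\<^esub> y"
      if "x \<in> carrier ?M" "y \<in> carrier ?M" "z \<in> carrier ?M" for x y z
      using that by (elim elim) (simp add: sm rdist)
    show "\<zero>\<^bsub>?M\<^esub> \<otimes>\<^bsub>?M\<^esub> x = \<zero>\<^bsub>?M\<^esub>" if "x \<in> carrier ?M" for x
      using that by (elim elim) (simp add: sm lz)
    show "x \<otimes>\<^bsub>?M\<^esub> \<zero>\<^bsub>?M\<^esub> = \<zero>\<^bsub>?M\<^esub>" if "x \<in> carrier ?M" for x
      using that by (elim elim) (simp add: sm rz)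
  qed
  ultimately show ?thesis
    by (intro commutative_semiring.intro Ring.semiring.intro comm_monoid.axioms(1))
qed

lemma fg_subsemimodules_idempotent:
  assumes "M \<in> carrier (fg_subsemimodules R A \<iota>)"
  shows "M \<oplus>\<^bsub>fg_subsemimodules R A \<iota>\<^esub> M = M"
  using assms span_add by (auto simp: fg_subsemimodules_def)

end

end

theory Submission
  imports Defs
begin

text \<open>
  In the idempotent semiring of finitely generated subsemimodules, \<open>M \<subseteq> N\<close> means
  \<open>M + N = N\<close>, so a subtractive ideal is an ideal that passes
  to smaller submodules. As every finitely generated submodule is a finite sum of principal ones,
  such a family \<open>P\<close> is determined by the elements \<open>a\<close> with \<open>\<langle>a\<rangle> \<in> P\<close>, that is by its
  pullback \<open>q\<close>: one has \<open>M \<in> P\<close> iff \<open>M \<subseteq> q\<close> (\<open>mem_iff_subset_pullback\<close>).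
  Hence the inverse of the pullback must send \<open>q\<close> to the family of all finitely generated
  submodules inside \<open>q\<close>.

  Both maps preserve primality. For the pullback this is the multiplicativity
  \<open>\<langle>a\<rangle>\<langle>b\<rangle> = \<langle>ab\<rangle>\<close>. For the inverse, if \<open>M\<close> and \<open>N\<close> are not inside \<open>q\<close>, then elements
  \<open>m \<in> M - q\<close> and \<open>n \<in> N - q\<close> give \<open>mn \<in> MN - q\<close>.
  Both maps are continuous because the closed sets correspond: the pullback of \<open>P\<close> contains
  \<open>S\<close> iff \<open>P\<close> contains all \<open>\<langle>s\<rangle>\<close> with \<open>s \<in> S\<close>, and all members of \<open>T\<close> are inside \<open>q\<close> iff
  \<open>\<Union>T \<subseteq> q\<close>.
\<close>

section \<open>Order and sums of finitely generated subsemimodules\<close>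

definition fg_subsemimodules_inside ::
    "('r, 'm) ring_scheme \<Rightarrow> ('a, 'n) ring_scheme \<Rightarrow> ('r \<Rightarrow> 'a) \<Rightarrow> 'a set \<Rightarrow> 'a set set"
  where "fg_subsemimodules_inside R A \<iota> q = {M \<in> carrier (fg_subsemimodules R A \<iota>). M \<subseteq> q}"

context semialgebra
begin

abbreviation fg where "fg \<equiv> fg_subsemimodules R A \<iota>"
abbreviation pullback where "pullback \<equiv> universal_valuation_pullback R A \<iota>"
abbreviation inside where "inside \<equiv> fg_subsemimodules_inside R A \<iota>"

lemma fg_carrierE:
  assumes "M \<in> carrier fg"
  obtains F where "finite F" "F \<subseteq> carrier A" "M = span F"
  using assms by (auto simp: fg_subsemimodules_def)

lemma span_in_fg: "finite F \<Longrightarrow> F \<subseteq> carrier A \<Longrightarrow> span F \<in> carrier fg"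
  by (auto simp: fg_subsemimodules_def)

lemma fg_subsemimodule: "M \<in> carrier fg \<Longrightarrow> subsemimodule R A \<iota> M"
  by (metis fg_carrierE subsemimodule_span)

lemma fg_subset_carrier: "M \<in> carrier fg \<Longrightarrow> M \<subseteq> carrier A"
  using fg_subsemimodule unfolding subsemimodule_def by blast

lemma fg_add: "M \<oplus>\<^bsub>fg\<^esub> N = M <+>\<^bsub>A\<^esub> N"
  and fg_mult: "M \<otimes>\<^bsub>fg\<^esub> N = span (M <#>\<^bsub>A\<^esub> N)"
  and fg_zero: "\<zero>\<^bsub>fg\<^esub> = {\<zero>\<^bsub>A\<^esub>}"
  and fg_one: "\<one>\<^bsub>fg\<^esub> = span {\<one>\<^bsub>A\<^esub>}"
  by (simp_all add: fg_subsemimodules_def)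

lemma span_subset_iff: "subsemimodule R A \<iota> N \<Longrightarrow> span X \<subseteq> N \<longleftrightarrow> X \<subseteq> N"
  using span_least span_superset by blast

lemma fg_add_absorb:
  assumes M: "M \<in> carrier fg" and N: "N \<in> carrier fg" and MN: "M \<subseteq> N"
  shows "M \<oplus>\<^bsub>fg\<^esub> N = N"
proof
  show "M \<oplus>\<^bsub>fg\<^esub> N \<subseteq> N"
    using fg_subsemimodule[OF N] MN unfolding fg_add subsemimodule_def
    by (auto simp: set_add_iff subset_iff)
  have "x = \<zero>\<^bsub>A\<^esub> \<oplus>\<^bsub>A\<^esub> x" if "x \<in> N" for x
    using that fg_subset_carrier[OF N] by auto
  moreover have "\<zero>\<^bsub>A\<^esub> \<in> M" using fg_subsemimodule[OF M] by (simp add: subsemimodule_def)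
  ultimately show "N \<subseteq> M \<oplus>\<^bsub>fg\<^esub> N" unfolding fg_add set_add_iff subset_iff by blast
qed

lemma fg_subset_add:
  assumes "M \<in> carrier fg" "N \<in> carrier fg"
  shows "M \<subseteq> M \<oplus>\<^bsub>fg\<^esub> N"
proof
  fix x assume x: "x \<in> M"
  then have "x = x \<oplus>\<^bsub>A\<^esub> \<zero>\<^bsub>A\<^esub>" using fg_subset_carrier[OF assms(1)] by auto
  moreover have "\<zero>\<^bsub>A\<^esub> \<in> N" using fg_subsemimodule[OF assms(2)] by (simp add: subsemimodule_def)
  ultimately show "x \<in> M \<oplus>\<^bsub>fg\<^esub> N" using x unfolding fg_add set_add_iff by blast
qed

section \<open>Subtractive ideals of finitely generated subsemimodules\<close>

lemma subtractive_downward_closed: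
  assumes P: "semiring_ideal fg P" "subtractive fg P"
    and "N \<in> P" "M \<in> carrier fg" "M \<subseteq> N"
  shows "M \<in> P"
proof -
  have "N \<in> carrier fg" using P \<open>N \<in> P\<close> by (auto simp: semiring_ideal_def)
  then have "M \<oplus>\<^bsub>fg\<^esub> N = N" using assms by (intro fg_add_absorb)
  then show ?thesis using assms unfolding subtractive_def by blast
qed

lemma span_in_ideal:
  assumes P: "semiring_ideal fg P"
    and "finite F" "F \<subseteq> carrier A" "\<And>a. a \<in> F \<Longrightarrow> span {a} \<in> P"
  shows "span F \<in> P"
  using assms(2-)
proof (induction F)
  case empty
  then show ?case using P by (simp add: semiring_ideal_def fg_zero span_empty)
next
  case (insert a F)
  then have "span {a} \<in> P" "span F \<in> P" by auto
  then have "span {a} \<oplus>\<^bsub>fg\<^esub> span F \<in> P" using P by (simp add: semiring_ideal_def)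
  then show ?case using insert.prems by (simp add: fg_add span_add)
qed

lemma mem_pullback_iff: "a \<in> pullback P \<longleftrightarrow> a \<in> carrier A \<and> span {a} \<in> P"
  by (simp add: universal_valuation_pullback_def universal_valuation_def)

text \<open>
  A subtractive ideal consists of the finitely generated submodules of its pullback: a member
  contains the principal submodules of its elements, and conversely is the sum of the
  principal submodules of its generators.
\<close>

lemma mem_iff_subset_pullback:
  assumes P: "semiring_ideal fg P" "subtractive fg P" and M: "M \<in> carrier fg"
  shows "M \<in> P \<longleftrightarrow> M \<subseteq> pullback P"
proof
  assume MP: "M \<in> P"
  show "M \<subseteq> pullback P"
  proof
    fix a assume a: "a \<in> M"
    then have ac: "a \<in> carrier A" using fg_subset_carrier[OF M] by blast
    have "span {a} \<subseteq> M" using a span_subset_iff[OF fg_subsemimodule[OF M]] by simp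
    then have "span {a} \<in> P"
      using subtractive_downward_closed[OF P MP span_in_fg] ac by simp
    then show "a \<in> pullback P" using ac by (simp add: mem_pullback_iff)
  qed
next
  assume sub: "M \<subseteq> pullback P"
  obtain F where F: "finite F" "F \<subseteq> carrier A" "M = span F" using fg_carrierE[OF M] .
  then have "F \<subseteq> pullback P" using sub span_superset by blast
  then have "span {a} \<in> P" if "a \<in> F" for a using that by (auto simp: mem_pullback_iff)
  then show "M \<in> P" using span_in_ideal[OF P(1) F(1,2)] F(3) by simp
qed

section \<open>Primality under the pullback and its inverse\<close>

lemma span_singleton_mult:
  assumes "a \<in> carrier A" "b \<in> carrier A"
  shows "span {a} \<otimes>\<^bsub>fg\<^esub> span {b} = span {a \<otimes>\<^bsub>A\<^esub> b}"
proof -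
  have "{a} <#>\<^bsub>A\<^esub> {b} = {a \<otimes>\<^bsub>A\<^esub> b}" by (auto simp: set_mult_iff)
  then show ?thesis using assms span_mult[of "{a}" "{b}"] by (simp add: fg_mult)
qed

text \<open>
  The universal valuation is multiplicative but only subadditive,
  \<open>\<langle>a + b\<rangle> \<subseteq> \<langle>a\<rangle> + \<langle>b\<rangle>\<close>; subtractivity is what makes the pullback closed under addition.
\<close>

lemma pullback_in_Spec:
  assumes "P \<in> Sp fg"
  shows "pullback P \<in> Spec A"
proof -
  have P: "semiring_ideal fg P" "subtractive fg P" and proper: "P \<noteq> carrier fg"
    and prime: "\<And>M N. M \<in> carrier fg \<Longrightarrow> N \<in> carrier fg \<Longrightarrow> M \<otimes>\<^bsub>fg\<^esub> N \<in> P \<Longrightarrow> M \<in> P \<or> N \<in> P"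
    using assms by (auto simp: Sp_def Spec_def prime_semiring_ideal_def)
  interpret fg: commutative_semiring fg by (rule fg_subsemimodules_semiring)
  have Pmult: "N \<otimes>\<^bsub>fg\<^esub> M \<in> P" if "N \<in> carrier fg" "M \<in> P" for M N
    using P that by (simp add: semiring_ideal_def)
  have principal: "span {a} \<in> carrier fg" if "a \<in> carrier A" for a
    using that by (simp add: span_in_fg)
  have zero: "\<zero>\<^bsub>A\<^esub> \<in> pullback P"
  proof -
    have "{\<zero>\<^bsub>A\<^esub>} \<in> P" using P by (simp add: semiring_ideal_def fg_zero)
    moreover have "span {\<zero>\<^bsub>A\<^esub>} \<subseteq> {\<zero>\<^bsub>A\<^esub>}"
      by (rule span_least) (auto simp: subsemimodule_def structure_closed)
    ultimately show ?thesis
      using subtractive_downward_closed[OF P _ principal] by (simp add: mem_pullback_iff)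
  qed
  have add: "a \<oplus>\<^bsub>A\<^esub> b \<in> pullback P" if ab: "a \<in> pullback P" "b \<in> pullback P" for a b
  proof -
    have c: "a \<in> carrier A" "b \<in> carrier A" using ab by (auto simp: mem_pullback_iff)
    have in_P: "span {a, b} \<in> P"
      using span_in_ideal[OF P(1), of "{a, b}"] ab by (auto simp: mem_pullback_iff)
    have s: "subsemimodule R A \<iota> (span {a, b})" using c by (simp add: subsemimodule_span)
    then have "a \<oplus>\<^bsub>A\<^esub> b \<in> span {a, b}"
      using span_superset[of "{a, b}"] by (simp add: subsemimodule_def)
    then have "span {a \<oplus>\<^bsub>A\<^esub> b} \<subseteq> span {a, b}" using s by (simp add: span_subset_iff)
    then show ?thesis
      using subtractive_downward_closed[OF P in_P principal] c by (simp add: mem_pullback_iff)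
  qed
  have mult: "r \<otimes>\<^bsub>A\<^esub> a \<in> pullback P" if "r \<in> carrier A" "a \<in> pullback P" for r a
    using that Pmult[OF principal, of r "span {a}"]
    by (simp add: mem_pullback_iff span_singleton_mult)
  have "\<one>\<^bsub>A\<^esub> \<notin> pullback P"
  proof
    assume "\<one>\<^bsub>A\<^esub> \<in> pullback P"
    then have "\<one>\<^bsub>fg\<^esub> \<in> P" by (simp add: mem_pullback_iff fg_one)
    then have "carrier fg \<subseteq> P" using Pmult fg.r_one by (metis subsetI)
    then show False using P(1) proper by (auto simp: semiring_ideal_def)
  qed
  then have "pullback P \<noteq> carrier A" using A.one_closed by metis
  moreover have "a \<in> pullback P \<or> b \<in> pullback P"
    if "a \<in> carrier A" "b \<in> carrier A" "a \<otimes>\<^bsub>A\<^esub> b \<in> pullback P" for a b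
    using that prime[of "span {a}" "span {b}"]
    by (simp add: mem_pullback_iff span_singleton_mult principal)
  ultimately show ?thesis
    using zero add mult
    by (auto simp: Spec_def prime_semiring_ideal_def semiring_ideal_def mem_pullback_iff)
qed

lemma ideal_subsemimodule: "semiring_ideal A q \<Longrightarrow> subsemimodule R A \<iota> q"
  by (auto simp: semiring_ideal_def subsemimodule_def structure_closed)

lemma inside_in_Sp:
  assumes "q \<in> Spec A"
  shows "inside q \<in> Sp fg"
proof -
  have q: "semiring_ideal A q" and proper: "q \<noteq> carrier A"
    and prime: "\<And>a b. a \<in> carrier A \<Longrightarrow> b \<in> carrier A \<Longrightarrow> a \<otimes>\<^bsub>A\<^esub> b \<in> q \<Longrightarrow> a \<in> q \<or> b \<in> q"
    using assms by (auto simp: Spec_def prime_semiring_ideal_def)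
  interpret fg: commutative_semiring fg by (rule fg_subsemimodules_semiring)
  have mem: "M \<in> inside q \<longleftrightarrow> M \<in> carrier fg \<and> M \<subseteq> q" for M
    by (simp add: fg_subsemimodules_inside_def)
  have qc: "q \<subseteq> carrier A" and qz: "\<zero>\<^bsub>A\<^esub> \<in> q"
    and qadd: "\<And>x y. x \<in> q \<Longrightarrow> y \<in> q \<Longrightarrow> x \<oplus>\<^bsub>A\<^esub> y \<in> q"
    and qmult: "\<And>a x. a \<in> carrier A \<Longrightarrow> x \<in> q \<Longrightarrow> a \<otimes>\<^bsub>A\<^esub> x \<in> q"
    using q by (auto simp: semiring_ideal_def)
  have "semiring_ideal fg (inside q)"
    unfolding semiring_ideal_def
  proof (intro conjI ballI)
    show "inside q \<subseteq> carrier fg" using mem by blast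
    show "\<zero>\<^bsub>fg\<^esub> \<in> inside q" using fg.zero_closed qz by (simp add: mem fg_zero)
    show "M \<oplus>\<^bsub>fg\<^esub> N \<in> inside q" if "M \<in> inside q" "N \<in> inside q" for M N
    proof -
      have "M \<oplus>\<^bsub>fg\<^esub> N \<subseteq> q"
        using that qadd by (auto simp: mem fg_add set_add_iff subset_iff)
      then show ?thesis using that by (simp add: mem)
    qed
    show "N \<otimes>\<^bsub>fg\<^esub> M \<in> inside q" if N: "N \<in> carrier fg" and M: "M \<in> inside q" for M N
    proof -
      have "N <#>\<^bsub>A\<^esub> M \<subseteq> q"
        using M fg_subset_carrier[OF N] qmult by (auto simp: mem set_mult_iff subset_iff)
      then have "N \<otimes>\<^bsub>fg\<^esub> M \<subseteq> q"
        using ideal_subsemimodule[OF q] by (simp add: fg_mult span_subset_iff)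
      then show ?thesis using N M by (simp add: mem)
    qed
  qed
  moreover have "inside q \<noteq> carrier fg"
  proof
    assume "inside q = carrier fg"
    then have "span {\<one>\<^bsub>A\<^esub>} \<subseteq> q" using fg.one_closed mem fg_one by metis
    then have "\<one>\<^bsub>A\<^esub> \<in> q" using span_superset by blast
    then have "carrier A \<subseteq> q" using qmult[of _ "\<one>\<^bsub>A\<^esub>"] by auto
    then show False using qc proper by blast
  qed
  moreover have "M \<in> inside q \<or> N \<in> inside q"
    if M: "M \<in> carrier fg" and N: "N \<in> carrier fg" and MN: "M \<otimes>\<^bsub>fg\<^esub> N \<in> inside q" for M N
  proof (rule ccontr)
    assume "\<not> ?thesis"
    then obtain m n where mn: "m \<in> M" "m \<notin> q" "n \<in> N" "n \<notin> q" using M N mem by blast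
    then have "m \<otimes>\<^bsub>A\<^esub> n \<in> M <#>\<^bsub>A\<^esub> N" unfolding set_mult_iff by blast
    then have "m \<otimes>\<^bsub>A\<^esub> n \<in> q" using MN span_superset unfolding mem fg_mult by blast
    then show False using mn prime fg_subset_carrier M N by blast
  qed
  moreover have "subtractive fg (inside q)"
    unfolding subtractive_def
  proof (intro ballI impI)
    fix M N K
    assume M: "M \<in> carrier fg" and N: "N \<in> inside q" and K: "K \<in> inside q" "M \<oplus>\<^bsub>fg\<^esub> N = K"
    then have "N \<in> carrier fg" "K \<subseteq> q" unfolding mem by blast+
    moreover have "M \<subseteq> K" using fg_subset_add[OF M \<open>N \<in> carrier fg\<close>] K(2) by simp
    ultimately show "M \<in> inside q" using M unfolding mem by blast
  qed
  ultimately show ?thesis by (simp add: Sp_def Spec_def prime_semiring_ideal_def)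
qed

lemma pullback_inside:
  assumes "q \<in> Spec A"
  shows "pullback (inside q) = q"
proof -
  have q: "semiring_ideal A q" using assms by (simp add: Spec_def prime_semiring_ideal_def)
  then have "q \<subseteq> carrier A" by (simp add: semiring_ideal_def)
  then show ?thesis
    using span_subset_iff[OF ideal_subsemimodule[OF q]]
    by (auto simp: mem_pullback_iff fg_subsemimodules_inside_def span_in_fg)
qed

lemma inside_pullback:
  assumes "P \<in> Sp fg"
  shows "inside (pullback P) = P"
proof -
  have P: "semiring_ideal fg P" "subtractive fg P"
    using assms by (auto simp: Sp_def Spec_def prime_semiring_ideal_def)
  then have "P \<subseteq> carrier fg" by (simp add: semiring_ideal_def)
  then show ?thesis
    using mem_iff_subset_pullback[OF P] by (auto simp: fg_subsemimodules_inside_def)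
qed

section \<open>Continuity in both directions\<close>

lemma closedin_Sp_fg:
  "closedin (Sp_topology fg) C \<longleftrightarrow>
    (\<exists>T. T \<subseteq> carrier fg \<and> C = zariski_closed fg T \<inter> Sp fg)"
proof -
  interpret fg: commutative_semiring fg by (rule fg_subsemimodules_semiring)
  show ?thesis unfolding Sp_topology_def closedin_subtopology fg.closedin_zariski by blast
qed

lemma continuous_map_pullback:
  "continuous_map (Sp_topology fg) (zariski_topology A) pullback"
  unfolding continuous_map_closedin
proof (intro conjI allI impI)
  interpret fg: commutative_semiring fg by (rule fg_subsemimodules_semiring)
  show "pullback \<in> topspace (Sp_topology fg) \<rightarrow> topspace (zariski_topology A)"
    by (simp add: fg.topspace_Sp A.topspace_zariski pullback_in_Spec)
  fix C assume "closedin (zariski_topology A) C"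
  then obtain S where S: "S \<subseteq> carrier A" "C = zariski_closed A S"
    unfolding A.closedin_zariski by blast
  have "S \<subseteq> pullback P \<longleftrightarrow> (\<lambda>a. span {a}) ` S \<subseteq> P" for P
    unfolding image_subset_iff
  proof
    show "\<forall>a\<in>S. span {a} \<in> P" if "S \<subseteq> pullback P"
      using that mem_pullback_iff by blast
    show "S \<subseteq> pullback P" if "\<forall>a\<in>S. span {a} \<in> P"
      using that S(1) mem_pullback_iff by blast
  qed
  then have "{P \<in> topspace (Sp_topology fg). pullback P \<in> C} =
      zariski_closed fg ((\<lambda>a. span {a}) ` S) \<inter> Sp fg"
    by (auto simp: S fg.topspace_Sp zariski_closed_def pullback_in_Spec Sp_def)
  moreover have "(\<lambda>a. span {a}) ` S \<subseteq> carrier fg" using S by (auto intro!: span_in_fg)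
  ultimately show "closedin (Sp_topology fg) {P \<in> topspace (Sp_topology fg). pullback P \<in> C}"
    unfolding closedin_Sp_fg by blast
qed

lemma continuous_map_inside:
  "continuous_map (zariski_topology A) (Sp_topology fg) inside"
  unfolding continuous_map_closedin
proof (intro conjI allI impI)
  interpret fg: commutative_semiring fg by (rule fg_subsemimodules_semiring)
  show "inside \<in> topspace (zariski_topology A) \<rightarrow> topspace (Sp_topology fg)"
    by (simp add: fg.topspace_Sp A.topspace_zariski inside_in_Sp)
  fix C assume "closedin (Sp_topology fg) C"
  then obtain T where T: "T \<subseteq> carrier fg" "C = zariski_closed fg T \<inter> Sp fg"
    unfolding closedin_Sp_fg by blast
  have "T \<subseteq> inside q \<longleftrightarrow> \<Union>T \<subseteq> q" for q
    using T(1) by (auto simp: fg_subsemimodules_inside_def)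
  moreover have "inside q \<in> Sp fg \<and> inside q \<in> Spec fg" if "q \<in> Spec A" for q
    using inside_in_Sp[OF that] by (simp add: Sp_def)
  ultimately have "{q \<in> topspace (zariski_topology A). inside q \<in> C} = zariski_closed A (\<Union>T)"
    by (auto simp: T(2) A.topspace_zariski zariski_closed_def)
  moreover have "\<Union>T \<subseteq> carrier A" using T(1) fg_subset_carrier by blast
  ultimately show "closedin (zariski_topology A) {q \<in> topspace (zariski_topology A). inside q \<in> C}"
    unfolding A.closedin_zariski by blast
qed

end

theorem theorem5p12:
  fixes R :: "('r, 'm) ring_scheme" and A :: "('a, 'n) ring_scheme" and \<iota> :: "'r \<Rightarrow> 'a"
  assumes "semialgebra R A \<iota>"
  shows "homeomorphic_map (Sp_topology (fg_subsemimodules R A \<iota>)) (zariski_topology A)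
           (universal_valuation_pullback R A \<iota>)"
proof -
  interpret semialgebra R A \<iota> by (rule assms)
  interpret fg: commutative_semiring fg by (rule fg_subsemimodules_semiring)
  have "homeomorphic_maps (Sp_topology fg) (zariski_topology A) pullback inside"
    by (simp add: homeomorphic_maps_def continuous_map_pullback continuous_map_inside
        fg.topspace_Sp A.topspace_zariski inside_pullback pullback_inside)
  then show ?thesis by (rule homeomorphic_maps_imp_map)
qed

end
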